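(* Let $G$ be a finite quasisimple group such that $\mathrm{Out}(G/Z(G))$ is trivial. Then $G$ has trivial Reidemeister spectrum and trivial extended Reidemeister spectrum, i.e. $\mathrm{Spec}_R(G)=\{k(G)\}$ and $\mathrm{ESpec}_R(G)=\{1,k(G)\}$.
   Context: A group $G$ is called quasisimple if $G$ is perfect, i.e. $G=[G,G]$, and $G/Z(G)$ is simple, where $Z(G)$ is the centre of $G$. $\mathrm{Out}(H)=\mathrm{Aut}(H)/\mathrm{Inn}(H)$ denotes the outer automorphism group of a group $H$. For an endomorphism $\varphi$ of a group $G$, two elements $g_1,g_2\in G$ are $\varphi$-twisted conjugate if there is $h\in G$ with $g_1=hg_2\varphi(h)^{-1}$; this is an equivalence relation, and the Reidemeister number $R(\varphi)$ is the number of its equivalence classes. The Reidemeister spectrum is $\mathrm{Spec}_R(G)=\{R(\varphi)\mid \varphi\in\mathrm{Aut}(G)\}$ and the extended Reidemeister spectrum is $\mathrm{ESpec}_R(G)=\{R(\varphi)\mid \varphi\in\mathrm{End}(G)\}$. $k(G)$ is the number of conjugacy classes of $G$. A finite group $G$ has trivial Reidemeister spectrum if $\mathrm{Spec}_R(G)=\{k(G)\}$, and trivial extended Reidemeister spectrum if $\mathrm{ESpec}_R(G)=\{1,k(G)\}$. *)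

theory Defs
  imports "HOL-Algebra.Algebra"
begin

definition center :: "('a, 'b) monoid_scheme \<Rightarrow> 'a set" where
  "center G = {z \<in> carrier G. \<forall>g \<in> carrier G. z \<otimes>\<^bsub>G\<^esub> g = g \<otimes>\<^bsub>G\<^esub> z}"

definition perfect_group :: "('a, 'b) monoid_scheme \<Rightarrow> bool" where
  "perfect_group G \<longleftrightarrow> group G \<and> derived G (carrier G) = carrier G"

text \<open>The library's \<^locale>\<open>simple_group\<close> demands \<open>order G > 1\<close>, and \<open>order\<close> is \<open>0\<close> for
  infinite carriers, so the following is the usual notion when \<open>G / Z(G)\<close> is finite.\<close>

definition quasisimple_group :: "('a, 'b) monoid_scheme \<Rightarrow> bool" where
  "quasisimple_group G \<longleftrightarrow> perfect_group G \<and> simple_group (G Mod center G)"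

text \<open>Elements of \<^const>\<open>AutoGroup\<close> are extensional functions, hence the restriction to the
  carrier.\<close>

definition inner_autos :: "('a, 'b) monoid_scheme \<Rightarrow> ('a \<Rightarrow> 'a) set" where
  "inner_autos G =
    (\<lambda>g. \<lambda>x \<in> carrier G. g \<otimes>\<^bsub>G\<^esub> x \<otimes>\<^bsub>G\<^esub> inv\<^bsub>G\<^esub> g) ` carrier G"

definition Out :: "('a, 'b) monoid_scheme \<Rightarrow> ('a \<Rightarrow> 'a) set monoid" where
  "Out G = AutoGroup G Mod inner_autos G"

definition conjugacy_rel :: "('a, 'b) monoid_scheme \<Rightarrow> ('a \<times> 'a) set" where
  "conjugacy_rel G = {(x, y). x \<in> carrier G \<and> y \<in> carrier G \<and>
     (\<exists>h \<in> carrier G. x = h \<otimes>\<^bsub>G\<^esub> y \<otimes>\<^bsub>G\<^esub> inv\<^bsub>G\<^esub> h)}"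

definition twisted_conjugacy_rel ::
    "('a, 'b) monoid_scheme \<Rightarrow> ('a \<Rightarrow> 'a) \<Rightarrow> ('a \<times> 'a) set" where
  "twisted_conjugacy_rel G \<phi> = {(x, y). x \<in> carrier G \<and> y \<in> carrier G \<and>
     (\<exists>h \<in> carrier G. x = h \<otimes>\<^bsub>G\<^esub> y \<otimes>\<^bsub>G\<^esub> inv\<^bsub>G\<^esub> (\<phi> h))}"

text \<open>The following cardinalities are natural numbers, so they are meaningful only when there
  are finitely many classes, in particular for finite \<open>G\<close>.\<close>

definition num_conjugacy_classes :: "('a, 'b) monoid_scheme \<Rightarrow> nat" where
  "num_conjugacy_classes G = card (carrier G // conjugacy_rel G)"

definition reidemeister_number :: "('a, 'b) monoid_scheme \<Rightarrow> ('a \<Rightarrow> 'a) \<Rightarrow> nat" where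
  "reidemeister_number G \<phi> = card (carrier G // twisted_conjugacy_rel G \<phi>)"

text \<open>Members of \<open>hom G G\<close> are arbitrary outside the carrier; this does not affect the
  Reidemeister number, which only depends on the values on the carrier.\<close>

definition reidemeister_spectrum :: "('a, 'b) monoid_scheme \<Rightarrow> nat set" where
  "reidemeister_spectrum G = {reidemeister_number G \<phi> | \<phi>. \<phi> \<in> auto G}"

definition extended_reidemeister_spectrum :: "('a, 'b) monoid_scheme \<Rightarrow> nat set" where
  "extended_reidemeister_spectrum G = {reidemeister_number G \<phi> | \<phi>. \<phi> \<in> hom G G}"

definition trivial_reidemeister_spectrum :: "('a, 'b) monoid_scheme \<Rightarrow> bool" where
  "trivial_reidemeister_spectrum G \<longleftrightarrow>
    reidemeister_spectrum G = {num_conjugacy_classes G}"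

definition trivial_extended_reidemeister_spectrum :: "('a, 'b) monoid_scheme \<Rightarrow> bool" where
  "trivial_extended_reidemeister_spectrum G \<longleftrightarrow>
    extended_reidemeister_spectrum G = {1, num_conjugacy_classes G}"

lemma (in group) center_normal: "center G \<lhd> G"
proof (rule normal_invI)
  show "subgroup (center G) G"
  proof (rule subgroupI)
    show "center G \<noteq> {}" by (auto simp: center_def intro!: exI[of _ \<one>])
  next
    fix a assume a: "a \<in> center G"
    then have ac: "a \<in> carrier G" by (simp add: center_def)
    { fix g assume g: "g \<in> carrier G"
      have "a \<otimes> inv g = inv g \<otimes> a" using a g by (simp add: center_def)
      then have "inv (a \<otimes> inv g) = inv (inv g \<otimes> a)" by simp
      then have "inv a \<otimes> g = g \<otimes> inv a" using ac g by (simp add: inv_mult_group) }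
    then show "inv a \<in> center G" using ac by (simp add: center_def)
  next
    fix a b assume "a \<in> center G" "b \<in> center G"
    then show "a \<otimes> b \<in> center G" unfolding center_def by (smt (verit) m_assoc m_closed mem_Collect_eq)
  qed (auto simp: center_def)
next
  fix x h assume xh: "x \<in> carrier G" "h \<in> center G"
  then have "x \<otimes> h = h \<otimes> x" "h \<in> carrier G" by (auto simp: center_def)
  then have "x \<otimes> h \<otimes> inv x = h" using xh by (simp add: m_assoc)
  then show "x \<otimes> h \<otimes> inv x \<in> center G" using xh by simp
qed

lemma (in group) equiv_twisted_conjugacy_rel:
  assumes "\<phi> \<in> hom G G"
  shows "equiv (carrier G) (twisted_conjugacy_rel G \<phi>)"
proof -
  interpret group_hom G G \<phi> using assms by unfold_locales
  have cl: "\<phi> h \<in> carrier G" if "h \<in> carrier G" for h using that by (rule hom_closed)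
  show ?thesis
  proof (rule equivI)
    show "twisted_conjugacy_rel G \<phi> \<subseteq> carrier G \<times> carrier G"
      by (auto simp: twisted_conjugacy_rel_def)
    show "refl_on (carrier G) (twisted_conjugacy_rel G \<phi>)"
      unfolding refl_on_def twisted_conjugacy_rel_def
      by (auto intro!: bexI[of _ \<one>])
    show "sym (twisted_conjugacy_rel G \<phi>)"
    proof (rule symI)
      fix x y assume "(x, y) \<in> twisted_conjugacy_rel G \<phi>"
      then obtain h where h: "x \<in> carrier G" "y \<in> carrier G" "h \<in> carrier G"
        "x = h \<otimes> y \<otimes> inv (\<phi> h)" by (auto simp: twisted_conjugacy_rel_def)
      have "inv h \<otimes> x \<otimes> inv (\<phi> (inv h)) = inv h \<otimes> (h \<otimes> y \<otimes> inv (\<phi> h)) \<otimes> \<phi> h"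
        using h by simp
      also have "\<dots> = y" using h(2,3) cl[OF h(3)] by (simp add: m_assoc inv_solve_left')
      finally show "(y, x) \<in> twisted_conjugacy_rel G \<phi>" using h
        by (auto simp: twisted_conjugacy_rel_def intro!: bexI[of _ "inv h"])
    qed
    show "trans (twisted_conjugacy_rel G \<phi>)"
    proof (rule transI)
      fix x y z assume "(x, y) \<in> twisted_conjugacy_rel G \<phi>" "(y, z) \<in> twisted_conjugacy_rel G \<phi>"
      then obtain h k where h: "x \<in> carrier G" "y \<in> carrier G" "z \<in> carrier G" "h \<in> carrier G"
        "k \<in> carrier G" "x = h \<otimes> y \<otimes> inv (\<phi> h)" "y = k \<otimes> z \<otimes> inv (\<phi> k)"
        by (auto simp: twisted_conjugacy_rel_def)
      have "x = (h \<otimes> k) \<otimes> z \<otimes> inv (\<phi> (h \<otimes> k))"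
        using h cl[OF h(4)] cl[OF h(5)] by (simp add: m_assoc inv_mult_group)
      then show "(x, z) \<in> twisted_conjugacy_rel G \<phi>" using h
        by (auto simp: twisted_conjugacy_rel_def intro!: bexI[of _ "h \<otimes> k"])
    qed
  qed
qed

lemma conjugacy_rel_eq: "conjugacy_rel G = twisted_conjugacy_rel G (\<lambda>x. x)"
  by (simp add: conjugacy_rel_def twisted_conjugacy_rel_def)

end

theory Submission
  imports Defs
begin

text \<open>The kernel of an endomorphism \<open>\<phi>\<close> of a quasisimple group \<open>G\<close> is either all of \<open>G\<close> or
  central (\<open>quasisimple_normal_subgroup\<close>). In the first case all elements are
  \<open>\<phi>\<close>-twisted conjugate, so \<open>R(\<phi>) = 1\<close>. In the second case counting in the finite group
  \<open>G / Z(G)\<close> shows that \<open>\<phi>\<close> is onto (\<open>perfect_endomorphism_central_kernel_surj\<close>). It then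
  induces an automorphism of \<open>G / Z(G)\<close>, which is inner by hypothesis, so \<open>\<phi>\<close> agrees with a
  conjugation up to central factors. These factors form a homomorphism from \<open>G\<close> to \<open>Z(G)\<close>, which
  is trivial because \<open>G\<close> is perfect. Hence \<open>\<phi>\<close> is itself a conjugation
  (\<open>perfect_surj_endomorphism_conjugation\<close>), and twisting by a conjugation does not change the
  number of classes (\<open>reidemeister_number_conjugation\<close>), so \<open>R(\<phi>) = k(G)\<close>.

  The values \<open>1\<close> and \<open>k(G)\<close> are attained by the trivial endomorphism and the identity.\<close>

section \<open>Counting twisted conjugacy classes\<close>

lemma card_quotient_bij_betw:
  assumes f: "bij_betw f A B" and r: "r \<subseteq> A \<times> A" and s: "s \<subseteq> B \<times> B"
    and rs: "\<And>x y. x \<in> A \<Longrightarrow> y \<in> A \<Longrightarrow> (x, y) \<in> r \<longleftrightarrow> (f x, f y) \<in> s"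
  shows "card (A // r) = card (B // s)"
proof -
  have cls: "s `` {f x} = f ` (r `` {x})" if "x \<in> A" for x
  proof -
    have "f ` A = B" using f by (simp add: bij_betw_def)
    then show ?thesis using that r s rs by (fastforce simp: image_iff)
  qed
  have "B // s = (\<lambda>x. s `` {f x}) ` A"
    using f by (auto simp: quotient_def bij_betw_def)
  also have "\<dots> = (`) f ` (A // r)"
    using cls by (auto simp: quotient_def)
  finally have "B // s = (`) f ` (A // r)" .
  moreover have "inj_on ((`) f) (A // r)"
  proof (rule inj_on_subset)
    show "inj_on ((`) f) (Pow A)" using f by (simp add: bij_betw_def inj_on_image_Pow)
    show "A // r \<subseteq> Pow A" using r by (auto simp: quotient_def)
  qed
  ultimately show ?thesis by (simp add: card_image)
qed

text \<open>If \<open>\<phi>\<close> is conjugation by \<open>a\<close>, then \<open>x = h y \<phi>(h)\<inverse>\<close> says \<open>x a = h (y a) h\<inverse>\<close>, so right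
  translation by \<open>a\<close> carries twisted conjugacy classes to ordinary ones.\<close>

lemma (in group) reidemeister_number_conjugation:
  assumes a: "a \<in> carrier G"
    and \<phi>: "\<And>x. x \<in> carrier G \<Longrightarrow> \<phi> x = a \<otimes> x \<otimes> inv a"
  shows "reidemeister_number G \<phi> = num_conjugacy_classes G"
  unfolding reidemeister_number_def num_conjugacy_classes_def
proof (rule card_quotient_bij_betw)
  show "bij_betw (\<lambda>x. x \<otimes> a) (carrier G) (carrier G)"
    by (rule bij_betw_byWitness[where f' = "\<lambda>x. x \<otimes> inv a"]) (auto simp: a m_assoc)
  fix x y assume x: "x \<in> carrier G" and y: "y \<in> carrier G"
  have "x = h \<otimes> y \<otimes> inv (\<phi> h) \<longleftrightarrow> x \<otimes> a = h \<otimes> (y \<otimes> a) \<otimes> inv h" if h: "h \<in> carrier G" for h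
  proof -
    have "h \<otimes> y \<otimes> inv (\<phi> h) = h \<otimes> (y \<otimes> a) \<otimes> inv h \<otimes> inv a"
      using a y h by (simp add: \<phi> inv_mult_group m_assoc)
    then show ?thesis using a x y h by (metis inv_closed inv_solve_right m_closed)
  qed
  then show "(x, y) \<in> twisted_conjugacy_rel G \<phi> \<longleftrightarrow> (x \<otimes> a, y \<otimes> a) \<in> conjugacy_rel G"
    using a x y by (auto simp: twisted_conjugacy_rel_def conjugacy_rel_def)
qed (auto simp: twisted_conjugacy_rel_def conjugacy_rel_def)

lemma (in group) reidemeister_number_trivial_hom:
  assumes "\<And>x. x \<in> carrier G \<Longrightarrow> \<phi> x = \<one>"
  shows "reidemeister_number G \<phi> = 1"
proof -
  have "\<exists>h \<in> carrier G. x = h \<otimes> y \<otimes> inv (\<phi> h)" if "x \<in> carrier G" "y \<in> carrier G" for x y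
    using that assms by (intro bexI[of _ "x \<otimes> inv y"]) (auto simp: m_assoc)
  then have "twisted_conjugacy_rel G \<phi> = carrier G \<times> carrier G"
    by (auto simp: twisted_conjugacy_rel_def)
  then have "carrier G // twisted_conjugacy_rel G \<phi> = {carrier G}"
    using one_closed by (auto simp: quotient_def)
  then show ?thesis by (simp add: reidemeister_number_def)
qed

section \<open>Perfect groups and their centre\<close>

lemma center_commute:
  assumes "z \<in> center G" "g \<in> carrier G"
  shows "z \<otimes>\<^bsub>G\<^esub> g = g \<otimes>\<^bsub>G\<^esub> z"
  using assms by (simp add: center_def)

lemma (in group) commutator_eq_one_iff:
  assumes "x \<in> carrier G" "y \<in> carrier G"
  shows "x \<otimes> y \<otimes> inv x \<otimes> inv y = \<one> \<longleftrightarrow> x \<otimes> y = y \<otimes> x"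
  using assms by (metis inv_closed inv_solve_right' l_one m_closed one_closed)

lemma (in group) perfect_subgroup_eq_carrier:
  assumes "perfect_group G" and H: "subgroup H G"
    and "\<And>x y. x \<in> carrier G \<Longrightarrow> y \<in> carrier G \<Longrightarrow> x \<otimes> y \<otimes> inv x \<otimes> inv y \<in> H"
  shows "H = carrier G"
proof
  have "derived G (carrier G) \<subseteq> H"
    unfolding derived_def using assms(3) by (intro generate_subgroup_incl[OF _ H]) auto
  then show "carrier G \<subseteq> H" using assms(1) by (simp add: perfect_group_def)
qed (rule subgroup.subset[OF H])

lemma (in group_hom) perfect_hom_abelian_image_trivial:
  assumes "perfect_group G"
    and comm: "\<And>x y. x \<in> carrier G \<Longrightarrow> y \<in> carrier G \<Longrightarrow> h x \<otimes>\<^bsub>H\<^esub> h y = h y \<otimes>\<^bsub>H\<^esub> h x"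
    and "x \<in> carrier G"
  shows "h x = \<one>\<^bsub>H\<^esub>"
proof -
  have "kernel G H h = carrier G"
  proof (rule G.perfect_subgroup_eq_carrier[OF assms(1) subgroup_kernel])
    fix x y assume "x \<in> carrier G" "y \<in> carrier G"
    then have "h (x \<otimes> y \<otimes> inv x \<otimes> inv y) = \<one>\<^bsub>H\<^esub>"
      using H.commutator_eq_one_iff[of "h x" "h y"] comm[of x y] by simp
    then show "x \<otimes> y \<otimes> inv x \<otimes> inv y \<in> kernel G H h"
      using \<open>x \<in> carrier G\<close> \<open>y \<in> carrier G\<close> by (simp add: kernel_def)
  qed
  then show ?thesis using assms(3) by (auto simp: kernel_def)
qed

text \<open>A central factor drops out of a commutator, so the commutators of \<open>G = H Z(G)\<close> are those
  of \<open>H\<close>.\<close>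

lemma (in group) perfect_subgroup_center_supplement:
  assumes "perfect_group G" and H: "subgroup H G"
    and sup: "\<And>x. x \<in> carrier G \<Longrightarrow> \<exists>h \<in> H. \<exists>z \<in> center G. x = z \<otimes> h"
  shows "H = carrier G"
proof (rule perfect_subgroup_eq_carrier[OF assms(1) H])
  interpret H: subgroup H G by (rule H)
  have conj: "(z \<otimes> h) \<otimes> g \<otimes> inv (z \<otimes> h) = h \<otimes> g \<otimes> inv h"
    if "z \<in> center G" "h \<in> carrier G" "g \<in> carrier G" for z h g
  proof -
    have z: "z \<in> carrier G" "z \<otimes> (h \<otimes> g \<otimes> inv h) = (h \<otimes> g \<otimes> inv h) \<otimes> z"
      using that by (auto simp: center_def)
    have "(z \<otimes> h) \<otimes> g \<otimes> inv (z \<otimes> h) = z \<otimes> (h \<otimes> g \<otimes> inv h) \<otimes> inv z"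
      using that z(1) by (simp add: inv_mult_group m_assoc)
    also have "\<dots> = (h \<otimes> g \<otimes> inv h) \<otimes> z \<otimes> inv z" by (simp only: z(2))
    also have "\<dots> = h \<otimes> g \<otimes> inv h" using that z(1) by (simp add: m_assoc)
    finally show ?thesis .
  qed
  fix x y assume xy: "x \<in> carrier G" "y \<in> carrier G"
  obtain h z where h: "h \<in> H" "z \<in> center G" "x = z \<otimes> h" using sup xy(1) by blast
  obtain k w where k: "k \<in> H" "w \<in> center G" "y = w \<otimes> k" using sup xy(2) by blast
  have hk: "h \<in> carrier G" "k \<in> carrier G" using h(1) k(1) by auto
  have "x \<otimes> y \<otimes> inv x \<otimes> inv y = h \<otimes> y \<otimes> inv h \<otimes> inv y"
    using conj[OF h(2) hk(1) xy(2)] h(3) by simp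
  also have "\<dots> = h \<otimes> (y \<otimes> inv h \<otimes> inv y)"
    using hk xy by (simp add: m_assoc)
  also have "\<dots> = h \<otimes> (k \<otimes> inv h \<otimes> inv k)"
    using conj[OF k(2) hk(2), of "inv h"] hk k(3) by simp
  also have "\<dots> \<in> H" using h(1) k(1) by simp
  finally show "x \<otimes> y \<otimes> inv x \<otimes> inv y \<in> H" .
qed

text \<open>Gruen's lemma that \<open>G / Z(G)\<close> has trivial centre, in terms of elements of \<open>G\<close>. The identity
  \<open>[x, g h] = [x, g] (g [x, h] g\<inverse>)\<close> shows that \<open>g \<mapsto> [x, g]\<close> is a homomorphism once its values
  are central; its image is then abelian, so it is trivial.\<close>

lemma (in group) perfect_central_mod_center:
  assumes "perfect_group G" and x: "x \<in> carrier G"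
    and cen: "\<And>g. g \<in> carrier G \<Longrightarrow> x \<otimes> g \<otimes> inv x \<otimes> inv g \<in> center G"
  shows "x \<in> center G"
proof -
  let ?c = "\<lambda>g. x \<otimes> g \<otimes> inv x \<otimes> inv g"
  have central: "?c g \<otimes> y = y \<otimes> ?c g" if "g \<in> carrier G" "y \<in> carrier G" for g y
    using cen[OF that(1)] that(2) by (rule center_commute)
  have cancel: "inv x \<otimes> (x \<otimes> y) = y" if "y \<in> carrier G" for y
    using x that by (simp flip: m_assoc)
  have "?c \<in> hom G G"
  proof (rule homI)
    fix g h assume gh: "g \<in> carrier G" "h \<in> carrier G"
    have "?c (g \<otimes> h) = x \<otimes> g \<otimes> inv x \<otimes> (?c h \<otimes> inv g)"
      using gh x by (simp add: inv_mult_group m_assoc cancel)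
    also have "\<dots> = x \<otimes> g \<otimes> inv x \<otimes> (inv g \<otimes> ?c h)"
      using central[of h "inv g"] gh by simp
    also have "\<dots> = ?c g \<otimes> ?c h"
      using gh x by (simp add: m_assoc)
    finally show "?c (g \<otimes> h) = ?c g \<otimes> ?c h" .
  qed (use x in simp)
  then interpret c: group_hom G G ?c by unfold_locales
  have "?c g = \<one>" if "g \<in> carrier G" for g
    using c.perfect_hom_abelian_image_trivial[OF assms(1) central that] that x by simp
  then show ?thesis using x by (simp add: center_def commutator_eq_one_iff)
qed

text \<open>Two homomorphisms from a perfect group that agree modulo the centre differ by a
  homomorphism to the centre, so they are equal.\<close>

lemma (in group) perfect_homs_eq_mod_center:
  assumes "perfect_group G" and \<phi>: "\<phi> \<in> hom G G" and \<psi>: "\<psi> \<in> hom G G"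
    and cen: "\<And>x. x \<in> carrier G \<Longrightarrow> \<phi> x \<otimes> inv (\<psi> x) \<in> center G"
    and x: "x \<in> carrier G"
  shows "\<phi> x = \<psi> x"
proof -
  interpret \<phi>: group_hom G G \<phi> using \<phi> by unfold_locales
  interpret \<psi>: group_hom G G \<psi> using \<psi> by unfold_locales
  let ?z = "\<lambda>x. \<phi> x \<otimes> inv (\<psi> x)"
  have central: "?z x \<otimes> y = y \<otimes> ?z x" if "x \<in> carrier G" "y \<in> carrier G" for x y
    using cen[OF that(1)] that(2) by (rule center_commute)
  have "?z \<in> hom G G"
  proof (rule homI)
    fix x y assume xy: "x \<in> carrier G" "y \<in> carrier G"
    have "?z (x \<otimes> y) = \<phi> x \<otimes> (?z y \<otimes> inv (\<psi> x))"
      using xy by (simp add: inv_mult_group m_assoc del: \<psi>.hom_inv flip: \<psi>.hom_inv)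
    also have "\<dots> = \<phi> x \<otimes> (inv (\<psi> x) \<otimes> ?z y)"
      using central[of y "inv (\<psi> x)"] xy by simp
    also have "\<dots> = ?z x \<otimes> ?z y"
      using xy by (simp add: m_assoc)
    finally show "?z (x \<otimes> y) = ?z x \<otimes> ?z y" .
  qed simp
  then interpret z: group_hom G G ?z by unfold_locales
  have "?z x = \<one>"
    using z.perfect_hom_abelian_image_trivial[OF assms(1) central x] by simp
  then show ?thesis using x by (simp add: inv_solve_right')
qed

section \<open>Endomorphisms of finite quasisimple groups\<close>

text \<open>The cosets of the inner automorphisms all coincide, so in particular the coset of \<open>\<alpha>\<close> is that
  of the identity.\<close>

lemma trivial_Out_conjugation:
  assumes "group H" and out: "trivial_group (Out H)"
    and hom: "\<alpha> \<in> hom H H" and bij: "bij_betw \<alpha> (carrier H) (carrier H)"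
  shows "\<exists>a \<in> carrier H. \<forall>x \<in> carrier H. \<alpha> x = a \<otimes>\<^bsub>H\<^esub> x \<otimes>\<^bsub>H\<^esub> inv\<^bsub>H\<^esub> a"
proof -
  interpret group H by (rule assms(1))
  let ?\<beta> = "restrict \<alpha> (carrier H)" and ?id = "\<lambda>x \<in> carrier H. x"
  \<comment> \<open>Only extensional functions belong to \<^const>\<open>auto\<close>, which \<open>\<alpha>\<close> need not be.\<close>
  have \<beta>: "?\<beta> \<in> auto H"
    using hom bij by (auto simp: auto_def Bij_def hom_def cong: bij_betw_cong)
  have "?id \<in> inner_autos H"
    unfolding inner_autos_def by (rule image_eqI[of _ _ "\<one>\<^bsub>H\<^esub>"]) auto
  moreover have "?id \<otimes>\<^bsub>AutoGroup H\<^esub> ?\<beta> = ?\<beta>"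
    using \<beta> id_in_auto by (auto simp: AutoGroup_def BijGroup_def auto_def Bij_imp_funcset)
  ultimately have "?\<beta> \<in> inner_autos H #>\<^bsub>AutoGroup H\<^esub> ?\<beta>"
    by (force simp: r_coset_def)
  also have "inner_autos H #>\<^bsub>AutoGroup H\<^esub> ?\<beta> \<in> carrier (Out H)"
    using \<beta> by (auto simp: Out_def carrier_FactGroup AutoGroup_def)
  then have "inner_autos H #>\<^bsub>AutoGroup H\<^esub> ?\<beta> = inner_autos H"
    using out by (simp add: trivial_group_def Out_def)
  finally obtain a where "a \<in> carrier H"
    "?\<beta> = (\<lambda>x \<in> carrier H. a \<otimes>\<^bsub>H\<^esub> x \<otimes>\<^bsub>H\<^esub> inv\<^bsub>H\<^esub> a)"
    unfolding inner_autos_def by (rule imageE)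
  then show ?thesis by (metis restrict_apply')
qed

lemma (in group) center_rcoset_eq_iff:
  assumes "x \<in> carrier G" "y \<in> carrier G"
  shows "center G #> x = center G #> y \<longleftrightarrow> x \<otimes> inv y \<in> center G"
proof -
  interpret Z: normal "center G" G by (rule center_normal)
  show ?thesis
    using assms Z.rcos_module[OF group_axioms assms(2,1)] 
      repr_independence[OF _ assms(2) Z.subgroup_axioms, of x] rcos_self[OF assms(1) Z.subgroup_axioms]
    by auto
qed

text \<open>The image of \<open>N\<close> in the simple group \<open>G / Z(G)\<close> is normal. If it is trivial, \<open>N\<close> is central;
  if it is everything, then \<open>N Z(G) = G\<close>, and \<open>N = G\<close> because \<open>G\<close> is perfect.\<close>

lemma (in group) quasisimple_normal_subgroup:
  assumes qs: "quasisimple_group G" and N: "N \<lhd> G"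
  shows "N \<subseteq> center G \<or> N = carrier G"
proof -
  let ?Q = "G Mod center G" and ?\<pi> = "\<lambda>x. center G #> x"
  interpret N: normal N G by (rule N)
  interpret Z: normal "center G" G by (rule center_normal)
  interpret Q: simple_group ?Q using qs by (simp add: quasisimple_group_def)
  interpret \<pi>: group_hom G ?Q ?\<pi> using Z.r_coset_hom_Mod by unfold_locales
  have "?\<pi> ` N \<lhd> ?Q"
  proof (rule Q.normal_invI)
    show "subgroup (?\<pi> ` N) ?Q" by (rule \<pi>.subgroup_img_is_subgroup[OF N.subgroup_axioms])
    fix U V assume "U \<in> carrier ?Q" "V \<in> ?\<pi> ` N"
    then obtain x n where x: "x \<in> carrier G" "U = ?\<pi> x" and n: "n \<in> N" "V = ?\<pi> n"
      by (auto simp: carrier_FactGroup)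
    have "U \<otimes>\<^bsub>?Q\<^esub> V \<otimes>\<^bsub>?Q\<^esub> inv\<^bsub>?Q\<^esub> U = ?\<pi> (x \<otimes> n \<otimes> inv x)"
      using x n by (simp del: mult_FactGroup)
    then show "U \<otimes>\<^bsub>?Q\<^esub> V \<otimes>\<^bsub>?Q\<^esub> inv\<^bsub>?Q\<^esub> U \<in> ?\<pi> ` N"
      using N.inv_op_closed2[OF x(1) n(1)] by auto
  qed
  then consider "?\<pi> ` N = carrier ?Q" | "?\<pi> ` N = {\<one>\<^bsub>?Q\<^esub>}"
    using Q.no_real_normal_subgroup by blast
  then show ?thesis
  proof cases
    case 1
    have "N = carrier G"
    proof (rule perfect_subgroup_center_supplement[OF _ N.subgroup_axioms])
      show "perfect_group G" using qs by (simp add: quasisimple_group_def)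
      fix x assume x: "x \<in> carrier G"
      then have "?\<pi> x \<in> ?\<pi> ` N" unfolding 1 by simp
      then obtain n where n: "n \<in> N" "?\<pi> x = ?\<pi> n" by auto
      then have "x \<otimes> inv n \<in> center G" using x by (simp add: center_rcoset_eq_iff)
      moreover have "x = x \<otimes> inv n \<otimes> n" using x n by (simp add: m_assoc)
      ultimately show "\<exists>h \<in> N. \<exists>z \<in> center G. x = z \<otimes> h" using n(1) by blast
    qed
    then show ?thesis ..
  next
    case 2
    have "n \<in> center G" if "n \<in> N" for n
    proof -
      have "center G #> n = center G" using 2 that by auto
      then show ?thesis
        using rcos_self[OF N.mem_carrier[OF that] Z.subgroup_axioms] by simp
    qed
    then show ?thesis by blast
  qed
qed

text \<open>If \<open>\<phi>(x)\<close> is central, then \<open>\<phi>\<close> kills all \<open>[x, g]\<close>, so these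
  lie in the kernel and are central, and hence so is \<open>x\<close>. Thus the composition of \<open>\<phi>\<close> with \<open>G \<rightarrow> G / Z(G)\<close> takes at
  least as many values as \<open>G / Z(G)\<close> has elements, i.e. \<open>\<phi>(G) Z(G) = G\<close>, and \<open>\<phi>(G) = G\<close> as \<open>G\<close> is
  perfect.\<close>

lemma (in group) perfect_endomorphism_central_kernel_surj:
  assumes fin: "finite (carrier G)" and pf: "perfect_group G" and hom: "\<phi> \<in> hom G G"
    and ker: "kernel G G \<phi> \<subseteq> center G"
  shows "\<phi> ` carrier G = carrier G"
proof -
  interpret Z: normal "center G" G by (rule center_normal)
  interpret \<phi>: group_hom G G \<phi> using hom by unfold_locales
  let ?\<pi> = "\<lambda>x. center G #> x"
  let ?f = "\<lambda>x. ?\<pi> (\<phi> x)"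
  have pre: "x \<in> center G" if x: "x \<in> carrier G" and c: "\<phi> x \<in> center G" for x
  proof (rule perfect_central_mod_center[OF pf x])
    fix g assume g: "g \<in> carrier G"
    have "\<phi> x \<otimes> \<phi> g = \<phi> g \<otimes> \<phi> x" using c g by (simp add: center_commute)
    then have "\<phi> (x \<otimes> g \<otimes> inv x \<otimes> inv g) = \<one>"
      using commutator_eq_one_iff[of "\<phi> x" "\<phi> g"] x g by simp
    then have "x \<otimes> g \<otimes> inv x \<otimes> inv g \<in> kernel G G \<phi>"
      using x g by (simp add: kernel_def)
    then show "x \<otimes> g \<otimes> inv x \<otimes> inv g \<in> center G" using ker by blast
  qed
  have f_inj: "?\<pi> x = ?\<pi> y" if xy: "x \<in> carrier G" "y \<in> carrier G" "?f x = ?f y" for x y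
  proof -
    have "\<phi> (x \<otimes> inv y) \<in> center G" using xy by (simp add: center_rcoset_eq_iff)
    then show ?thesis using xy pre[of "x \<otimes> inv y"] by (simp add: center_rcoset_eq_iff)
  qed
  \<comment> \<open>\<open>s\<close> maps the values of \<open>?f\<close> onto the quotient, which bounds their number from below.\<close>
  then obtain s where s: "\<And>x. x \<in> carrier G \<Longrightarrow> ?\<pi> x = s (?f x)"
    using function_factors_left_gen[of "\<lambda>x. x \<in> carrier G" ?f ?\<pi>] by blast
  have "?f ` carrier G = ?\<pi> ` carrier G"
  proof (rule card_seteq)
    have "?\<pi> ` carrier G \<subseteq> s ` ?f ` carrier G" using s by blast
    then show "card (?\<pi> ` carrier G) \<le> card (?f ` carrier G)"
      using fin by (intro surj_card_le) auto
  qed (use fin in auto)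
  then have surj: "\<exists>y \<in> carrier G. ?\<pi> x = ?f y" if "x \<in> carrier G" for x
    using that by (metis (no_types, lifting) image_iff)
  show ?thesis
  proof (rule perfect_subgroup_center_supplement[OF pf \<phi>.img_is_subgroup])
    fix x assume x: "x \<in> carrier G"
    then obtain y where y: "y \<in> carrier G" "?\<pi> x = ?f y" using surj by blast
    then have "x \<otimes> inv (\<phi> y) \<in> center G" using x by (simp add: center_rcoset_eq_iff)
    moreover have "x = x \<otimes> inv (\<phi> y) \<otimes> \<phi> y" using x y by (simp add: m_assoc)
    ultimately show "\<exists>h \<in> \<phi> ` carrier G. \<exists>z \<in> center G. x = z \<otimes> h" using y(1) by blast
  qed
qed

text \<open>A surjective \<open>\<phi>\<close> preserves the centre and so induces an automorphism of \<open>G / Z(G)\<close>. As this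
  is conjugation by some \<open>a Z(G)\<close>, \<open>\<phi>\<close> agrees with conjugation by \<open>a\<close> modulo the centre.\<close>

lemma (in group) perfect_surj_endomorphism_conjugation:
  assumes fin: "finite (carrier G)" and pf: "perfect_group G"
    and out: "trivial_group (Out (G Mod center G))"
    and hom: "\<phi> \<in> hom G G" and surj: "\<phi> ` carrier G = carrier G"
  shows "\<exists>a \<in> carrier G. \<forall>x \<in> carrier G. \<phi> x = a \<otimes> x \<otimes> inv a"
proof -
  let ?Q = "G Mod center G" and ?\<pi> = "\<lambda>x. center G #> x"
  interpret Z: normal "center G" G by (rule center_normal)
  interpret \<phi>: group_hom G G \<phi> using hom by unfold_locales
  interpret Q: group ?Q by (rule Z.factorgroup_is_group)
  interpret \<pi>: group_hom G ?Q ?\<pi> using Z.r_coset_hom_Mod by unfold_locales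
  have cen: "\<phi> z \<in> center G" if z: "z \<in> center G" for z
  proof -
    have zc: "z \<in> carrier G" using z by simp
    have "\<phi> z \<otimes> \<phi> y = \<phi> y \<otimes> \<phi> z" if "y \<in> carrier G" for y
      using center_commute[OF z that] \<phi>.hom_mult[OF zc that] \<phi>.hom_mult[OF that zc] by simp
    then have "\<phi> z \<otimes> g = g \<otimes> \<phi> z" if "g \<in> carrier G" for g
      using that surj by (metis imageE)
    then show ?thesis unfolding center_def using zc \<phi>.hom_closed by blast
  qed
  obtain \<alpha> where \<alpha>: "\<alpha> \<in> hom ?Q ?Q" "\<And>x. x \<in> carrier G \<Longrightarrow> \<alpha> (?\<pi> x) = ?\<pi> (\<phi> x)"
  proof (rule FactGroup_universal[OF _ center_normal])
    show "(\<lambda>x. ?\<pi> (\<phi> x)) \<in> hom G ?Q"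
      using Group.hom_compose[OF hom \<pi>.homh] by (simp add: comp_def)
    fix x y assume xy: "x \<in> carrier G" "y \<in> carrier G" "?\<pi> x = ?\<pi> y"
    then have "\<phi> (x \<otimes> inv y) \<in> center G" using cen center_rcoset_eq_iff by blast
    then show "?\<pi> (\<phi> x) = ?\<pi> (\<phi> y)" using xy by (simp add: center_rcoset_eq_iff)
  qed blast
  have "\<alpha> ` carrier ?Q = (\<lambda>x. ?\<pi> x) ` \<phi> ` carrier G"
    using \<alpha>(2) by (simp add: carrier_FactGroup image_image)
  then have "\<alpha> ` carrier ?Q = carrier ?Q" by (simp add: surj carrier_FactGroup)
  moreover have "finite (carrier ?Q)" using fin by (simp add: carrier_FactGroup)
  ultimately have "bij_betw \<alpha> (carrier ?Q) (carrier ?Q)"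
    by (simp add: bij_betw_def eq_card_imp_inj_on)
  from trivial_Out_conjugation[OF Q.group_axioms out \<alpha>(1) this]
  obtain A where A: "A \<in> carrier ?Q" "\<forall>U \<in> carrier ?Q. \<alpha> U = A \<otimes>\<^bsub>?Q\<^esub> U \<otimes>\<^bsub>?Q\<^esub> inv\<^bsub>?Q\<^esub> A"
    by blast
  obtain a where a: "a \<in> carrier G" "A = ?\<pi> a" using A(1) by (auto simp: carrier_FactGroup)
  let ?c = "\<lambda>x. a \<otimes> x \<otimes> inv a"
  have c: "?c \<in> hom G G"
  proof (rule homI)
    fix x y assume "x \<in> carrier G" "y \<in> carrier G"
    moreover from this have "inv a \<otimes> (a \<otimes> (y \<otimes> inv a)) = y \<otimes> inv a"
      using a by (simp flip: m_assoc)
    ultimately show "?c (x \<otimes> y) = ?c x \<otimes> ?c y" using a by (simp add: m_assoc)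
  qed (use a in simp)
  have "\<phi> x \<otimes> inv (?c x) \<in> center G" if x: "x \<in> carrier G" for x
  proof -
    have "?\<pi> (\<phi> x) = ?\<pi> a \<otimes>\<^bsub>?Q\<^esub> ?\<pi> x \<otimes>\<^bsub>?Q\<^esub> inv\<^bsub>?Q\<^esub> ?\<pi> a"
      using A(2) \<alpha>(2) a x \<pi>.hom_closed by metis
    also have "\<dots> = ?\<pi> (?c x)" using a x by (simp del: mult_FactGroup)
    finally have "?\<pi> (\<phi> x) = ?\<pi> (?c x)" .
    then show ?thesis using center_rcoset_eq_iff[of "\<phi> x" "?c x"] a x by simp
  qed
  then have "\<phi> x = ?c x" if "x \<in> carrier G" for x
    using perfect_homs_eq_mod_center[OF pf hom c _ that] by blast
  then show ?thesis using a by blast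
qed

theorem proposition4p6:
  fixes G :: "('a, 'b) monoid_scheme"
  assumes "finite (carrier G)"
    and "quasisimple_group G"
    and "trivial_group (Out (G Mod center G))"
  shows "trivial_reidemeister_spectrum G \<and> trivial_extended_reidemeister_spectrum G"
proof -
  have pf: "perfect_group G" using assms(2) by (simp add: quasisimple_group_def)
  then interpret group G by (simp add: perfect_group_def)
  have surj: "reidemeister_number G \<phi> = num_conjugacy_classes G"
    if "\<phi> \<in> hom G G" "\<phi> ` carrier G = carrier G" for \<phi>
    using perfect_surj_endomorphism_conjugation[OF assms(1) pf assms(3) that]
      reidemeister_number_conjugation by blast
  have endo: "reidemeister_number G \<phi> \<in> {1, num_conjugacy_classes G}" if \<phi>: "\<phi> \<in> hom G G" for \<phi>
  proof -
    interpret \<phi>: group_hom G G \<phi> using \<phi> by unfold_locales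
    from quasisimple_normal_subgroup[OF assms(2) \<phi>.normal_kernel] show ?thesis
    proof
      assume "kernel G G \<phi> \<subseteq> center G"
      then show ?thesis
        using perfect_endomorphism_central_kernel_surj[OF assms(1) pf \<phi>] surj[OF \<phi>] by simp
    next
      assume "kernel G G \<phi> = carrier G"
      then have "reidemeister_number G \<phi> = 1"
        by (intro reidemeister_number_trivial_hom) (auto simp: kernel_def)
      then show ?thesis by simp
    qed
  qed
  have auto_surj: "\<phi> \<in> hom G G" "\<phi> ` carrier G = carrier G" if "\<phi> \<in> auto G" for \<phi>
    using that by (auto simp: auto_def Bij_def bij_betw_def)
  have auto_number: "reidemeister_number G \<phi> = num_conjugacy_classes G" if "\<phi> \<in> auto G" for \<phi>
    by (intro surj auto_surj that)
  have "reidemeister_spectrum G = reidemeister_number G ` auto G"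
    by (simp add: reidemeister_spectrum_def setcompr_eq_image)
  also have "\<dots> = {num_conjugacy_classes G}"
    using image_constant[OF id_in_auto] auto_number by (simp cong: image_cong)
  finally have "reidemeister_spectrum G = {num_conjugacy_classes G}" .
  moreover have "1 \<in> extended_reidemeister_spectrum G"
    unfolding extended_reidemeister_spectrum_def
  proof (intro CollectI exI conjI)
    show "1 = reidemeister_number G (\<lambda>_. \<one>\<^bsub>G\<^esub>)" by (simp add: reidemeister_number_trivial_hom)
  qed (simp add: hom_def)
  moreover have "num_conjugacy_classes G \<in> extended_reidemeister_spectrum G"
    unfolding extended_reidemeister_spectrum_def
  proof (intro CollectI exI conjI)
    show "num_conjugacy_classes G = reidemeister_number G (\<lambda>x \<in> carrier G. x)"
      by (rule auto_number[OF id_in_auto, symmetric])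
  qed (rule auto_surj(1)[OF id_in_auto])
  moreover have "extended_reidemeister_spectrum G \<subseteq> {1, num_conjugacy_classes G}"
    unfolding extended_reidemeister_spectrum_def using endo
    by (intro subsetI) (elim CollectE exE conjE, simp)
  ultimately show ?thesis
    unfolding trivial_reidemeister_spectrum_def trivial_extended_reidemeister_spectrum_def by blast
qed

end
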